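(* For every positive integer $d$ there is an oriented regular hypermap with duality index equal to $d$.
   Context: An oriented regular hypermap is a triple $\mathcal{H}=(G,x,y)$ where $G$ is a group generated by the ordered pair $x,y$ (equivalently, $G=\Delta^+/H$ for a normal subgroup $H$ of the free group $\Delta^+$ of rank $2$, with $x,y$ the images of the two free generators). The group $G$ is the monodromy group $Mon(\mathcal{H})$. Such a hypermap is self-dual if there is an automorphism of $G$ interchanging $x$ and $y$. The duality group $D(\mathcal{H})$ is the smallest normal subgroup $N\trianglelefteq G$ such that the assignment $x\mapsto y$, $y\mapsto x$ induces an automorphism of $G/N$ (equivalently, such that $\mathcal{H}/N=(G/N,xN,yN)$ is self-dual). The duality index of $\mathcal{H}$ is $|D(\mathcal{H})|$. *)

theory Defs
  imports "HOL-Algebra.Algebra"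
begin

text \<open>A hypermap is the triple \<open>(G, x, y)\<close> of its monodromy group and the ordered
  pair of distinguished generators.\<close>

type_synonym 'a hypermap = "'a monoid \<times> 'a \<times> 'a"

fun oriented_regular_hypermap :: "'a hypermap \<Rightarrow> bool" where
  "oriented_regular_hypermap (G, x, y) \<longleftrightarrow>
     group G \<and> x \<in> carrier G \<and> y \<in> carrier G \<and> generate G {x, y} = carrier G"

fun mon :: "'a hypermap \<Rightarrow> 'a monoid" where
  "mon (G, x, y) = G"

fun self_dual :: "'a hypermap \<Rightarrow> bool" where
  "self_dual (G, x, y) \<longleftrightarrow> (\<exists>\<phi> \<in> iso G G. \<phi> x = y \<and> \<phi> y = x)"

fun quotient_hypermap :: "'a hypermap \<Rightarrow> 'a set \<Rightarrow> 'a set hypermap" where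
  "quotient_hypermap (G, x, y) N = (G Mod N, N #>\<^bsub>G\<^esub> x, N #>\<^bsub>G\<^esub> y)"

text \<open>\<open>LEAST\<close> is with respect to inclusion. The least element exists for every oriented
  regular hypermap: normal subgroups with self-dual quotient include the whole group and
  are closed under intersection, since pulled back to the free group on the two generators
  they are the normal subgroups that contain the kernel and are invariant under exchanging
  the free generators.\<close>

definition duality_group :: "'a hypermap \<Rightarrow> 'a set" where
  "duality_group H = (LEAST N. N \<lhd> mon H \<and> self_dual (quotient_hypermap H N))"

text \<open>\<open>card\<close> is 0 on infinite sets, so a positive value means a finite duality group of
  exactly that order.\<close>

definition duality_index :: "'a hypermap \<Rightarrow> nat" where
  "duality_index H = card (duality_group H)"

end

theory Submission imports Defs begin

text \<open>The definition of a hypermap allows one of the two generators to be trivial, and such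
  hypermaps are as far from self-dual as possible: if \<open>G\<close> is generated by \<open>x\<close> and \<open>\<one>\<close>, then
  a duality of a quotient \<open>G/N\<close> carries the coset \<open>N\<close> of \<open>\<one>\<close>, the identity of \<open>G/N\<close>, to the
  coset of \<open>x\<close>. Homomorphisms preserve the identity, so \<open>x \<in> N\<close> and hence \<open>N = G\<close>. Thus the
  duality group is all of \<open>G\<close> (lemma \<open>duality_group_trivial_generator\<close>), and the cyclic group
  of order \<open>d\<close> with generators \<open>1\<close> and \<open>0\<close> has duality index \<open>d\<close>.\<close>

lemma self_dual_quotient_by_carrier:
  assumes "group G" "x \<in> carrier G" "y \<in> carrier G"
  shows "self_dual (quotient_hypermap (G, x, y) (carrier G))"
proof -
  interpret group G by fact
  have "carrier G #>\<^bsub>G\<^esub> z = carrier G" if "z \<in> carrier G" for z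
    using that subgroup_self coset_join2 by blast
  then have "carrier G #>\<^bsub>G\<^esub> x = carrier G #>\<^bsub>G\<^esub> y"
    using assms by simp
  then show ?thesis
    by (auto intro!: bexI[OF _ iso_set_refl])
qed

lemma mem_if_self_dual_quotient_trivial_generator:
  assumes N: "N \<lhd> G" and x: "x \<in> carrier G"
    and dual: "self_dual (quotient_hypermap (G, x, \<one>\<^bsub>G\<^esub>) N)"
  shows "x \<in> N"
proof -
  interpret normal N G by (rule N)
  obtain \<phi> where iso: "\<phi> \<in> iso (G Mod N) (G Mod N)"
    and swap: "\<phi> (N #>\<^bsub>G\<^esub> \<one>\<^bsub>G\<^esub>) = N #>\<^bsub>G\<^esub> x"
    using dual by auto
  have "\<phi> \<one>\<^bsub>G Mod N\<^esub> = \<one>\<^bsub>G Mod N\<^esub>"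
    using iso factorgroup_is_group hom_one by (metis iso_imp_homomorphism)
  moreover have "N #>\<^bsub>G\<^esub> \<one>\<^bsub>G\<^esub> = \<one>\<^bsub>G Mod N\<^esub>" "N = \<one>\<^bsub>G Mod N\<^esub>"
    using subset coset_mult_one by (auto simp: FactGroup_def)
  ultimately have "N #>\<^bsub>G\<^esub> x = N"
    using swap by simp
  then show ?thesis
    using x subgroup_axioms coset_join1 subset by blast
qed

text \<open>The whole group is the only admissible normal subgroup here: an admissible \<open>N\<close> contains
  both generators.\<close>

lemma duality_group_trivial_generator:
  assumes G: "group G" and x: "x \<in> carrier G"
    and gen: "generate G {x, \<one>\<^bsub>G\<^esub>} = carrier G"
  shows "duality_group (G, x, \<one>\<^bsub>G\<^esub>) = carrier G"
  unfolding duality_group_def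
proof (rule Least_equality)
  interpret group G by (rule G)
  have "carrier G \<lhd> G"
    by (simp add: normal_inv_iff subgroup_self)
  then show "carrier G \<lhd> mon (G, x, \<one>\<^bsub>G\<^esub>) \<and>
      self_dual (quotient_hypermap (G, x, \<one>\<^bsub>G\<^esub>) (carrier G))"
    using self_dual_quotient_by_carrier[OF G x one_closed] by simp
next
  fix N assume N: "N \<lhd> mon (G, x, \<one>\<^bsub>G\<^esub>) \<and>
      self_dual (quotient_hypermap (G, x, \<one>\<^bsub>G\<^esub>) N)"
  then interpret normal N G by simp
  have "{x, \<one>\<^bsub>G\<^esub>} \<subseteq> N"
    using N mem_if_self_dual_quotient_trivial_generator[of N G x] x by simp
  then show "carrier G \<le> N"
    using generate_subgroup_incl[OF _ subgroup_axioms] gen by blast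
qed

definition nat_mod_group :: "nat \<Rightarrow> nat monoid" where
  "nat_mod_group d = \<lparr>carrier = {..<d}, monoid.mult = (\<lambda>a b. (a + b) mod d), one = 0\<rparr>"

lemma group_nat_mod_group:
  assumes "d > 0"
  shows "group (nat_mod_group d)"
proof (rule groupI)
  fix a assume "a \<in> carrier (nat_mod_group d)"
  then have "(d - a) mod d \<in> carrier (nat_mod_group d)"
    "(d - a) mod d \<otimes>\<^bsub>nat_mod_group d\<^esub> a = \<one>\<^bsub>nat_mod_group d\<^esub>"
    using assms by (auto simp: nat_mod_group_def mod_simps)
  then show "\<exists>b \<in> carrier (nat_mod_group d). b \<otimes>\<^bsub>nat_mod_group d\<^esub> a = \<one>\<^bsub>nat_mod_group d\<^esub>"
    by blast
qed (use assms in \<open>auto simp: nat_mod_group_def mod_simps add.assoc\<close>)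

text \<open>The generator is \<open>1 mod d\<close> rather than \<open>1\<close> so that it lies in the carrier
  when \<open>d = 1\<close>.\<close>

lemma generate_nat_mod_group:
  assumes "d > 0"
  shows "generate (nat_mod_group d) {1 mod d, 0} = carrier (nat_mod_group d)"
    (is "generate ?G ?S = _")
proof
  interpret group ?G by (rule group_nat_mod_group[OF assms])
  have "?S \<subseteq> carrier ?G"
    using assms by (auto simp: nat_mod_group_def)
  then show "generate ?G ?S \<subseteq> carrier ?G"
    by (rule generate_incl)
  have "k mod d \<in> generate ?G ?S" for k
  proof (induction k)
    case 0
    then show ?case by (auto intro: generate.incl)
  next
    case (Suc k)
    have "(k mod d) \<otimes>\<^bsub>?G\<^esub> (1 mod d) \<in> generate ?G ?S"
      by (rule generate.eng[OF Suc.IH generate.incl]) simp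
    moreover have "(k mod d) \<otimes>\<^bsub>?G\<^esub> (1 mod d) = Suc k mod d"
      by (simp only: nat_mod_group_def monoid.simps mod_add_eq Suc_eq_plus1)
    ultimately show ?case
      by simp
  qed
  then show "carrier ?G \<subseteq> generate ?G ?S"
    by (metis lessThan_iff mod_less nat_mod_group_def partial_object.select_convs(1) subsetI)
qed

theorem theorem4p3:
  fixes d :: nat
  assumes "d > 0"
  shows "\<exists>H :: nat hypermap. oriented_regular_hypermap H \<and> duality_index H = d"
proof (intro exI conjI)
  let ?G = "nat_mod_group d"
  have one: "\<one>\<^bsub>?G\<^esub> = 0" and mem: "1 mod d \<in> carrier ?G" "0 \<in> carrier ?G"
    and card: "card (carrier ?G) = d"
    using assms by (auto simp: nat_mod_group_def)
  note grp = group_nat_mod_group[OF assms] and gen = generate_nat_mod_group[OF assms]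
  show "oriented_regular_hypermap (?G, 1 mod d, 0)"
    using grp gen mem by simp
  show "duality_index (?G, 1 mod d, 0) = d"
    using duality_group_trivial_generator[OF grp mem(1)] gen card
    by (simp add: one duality_index_def)
qed

end
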